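(* Let $\Bbbk$ be a field of characteristic zero, viewed as a symmetric Frobenius algebra over itself with identity trace map (so $C(\Bbbk)=\Bbbk$). The linear map $\mathfrak W(\Bbbk)\to\mathfrak W_{1+\infty}$ determined by \[ X^rz^n\mapsto\left(D+\tfrac{n+1}{2}\right)^rz^n\quad(r\in\mathbb N,\ n\in\mathbb Z),\qquad C\mapsto C, \] is an isomorphism of Lie algebras.
   Context: $\mathbb N$ includes $0$. For $A=\Bbbk$ with trace map the identity, the product $\diamond$ is ordinary multiplication and $\kappa=1$, and the Frobenius W-algebra $\mathfrak W(\Bbbk)$ is the Lie algebra $\Bbbk[X,z^{\pm1}]\oplus\Bbbk C$ with $C$ central and \[ [f(X)z^m,g(X)z^n]=\big(f\star_{m,n}g\big)z^{m+n}+\Psi(fz^m,gz^n)C, \] where \[ f\star_{m,n}g=\left.\frac{f(X+\frac n2Y)g(X-\frac m2Y)-f(X-\frac n2Y)g(X+\frac m2Y)}{Y}\right|_{Y^2=1} \] (the quotient is a polynomial in $X$ and $Y^2$), and, writing $f_{(m)}(X^2)=\sum_{j=1}^mf(\frac{m+1-2j}{2}X)\in\Bbbk[X^2]$ for $m\in\mathbb N$ and $f_{(m)}(1)$ for its value at $X^2=1$, $\Psi(fz^m,gz^n)$ equals $(fg)_{(m)}(1)$ if $m=-n\ge0$, $-(fg)_{(n)}(1)$ if $m=-n<0$, and $0$ if $m\neq-n$. $\mathfrak W_{1+\infty}$ is the Lie algebra with basis $\{C,\ w_{n,r}: n\in\mathbb Z,\ r\in\mathbb N\}$. Write $w_{n,r}=D^rz^n$,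 and for a polynomial (or power series in formal variables with polynomial coefficients) $f(D)=\sum_rf_rD^r$ write $f(D)z^n=\sum_rf_rw_{n,r}$. The bracket is given, with $C$ central and $u,v$ formal variables, by \[ [\exp(uD)z^m,\exp(vD)z^n]=\big(\exp(nu)-\exp(mv)\big)\exp(uD+vD)z^{m+n}+\delta_{m,-n}\frac{\exp(-mu)-\exp(-nv)}{1-\exp(u+v)}C . \] *)

theory Defs
  imports
    "HOL-Library.Poly_Mapping"
    "HOL-Library.Product_Plus"
    "HOL-Computational_Algebra.Computational_Algebra"
begin

section \<open>Lie algebras\<close>

locale lie_algebra = vector_space scale
  for scale :: "'k::field \<Rightarrow> 'l::ab_group_add \<Rightarrow> 'l" +
  fixes bracket :: "'l \<Rightarrow> 'l \<Rightarrow> 'l"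
  assumes linear_left: "Vector_Spaces.linear scale scale (\<lambda>x. bracket x y)"
    and linear_right: "Vector_Spaces.linear scale scale (\<lambda>y. bracket x y)"
    and alternating: "bracket x x = 0"
    and jacobi: "bracket x (bracket y z) + bracket y (bracket z x) + bracket z (bracket x y) = 0"

locale lie_algebra_iso =
  dom: lie_algebra scale1 bracket1 +
  cod: lie_algebra scale2 bracket2 +
  Vector_Spaces.linear scale1 scale2 f
  for scale1 :: "'k::field \<Rightarrow> 'l::ab_group_add \<Rightarrow> 'l"
    and bracket1 :: "'l \<Rightarrow> 'l \<Rightarrow> 'l"
    and scale2 :: "'k \<Rightarrow> 'm::ab_group_add \<Rightarrow> 'm"
    and bracket2 :: "'m \<Rightarrow> 'm \<Rightarrow> 'm"
    and f :: "'l \<Rightarrow> 'm" +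
  assumes map_bracket: "f (bracket1 x y) = bracket2 (f x) (f y)"
    and bij: "bij f"


section \<open>The Frobenius W-algebra of the base field\<close>

text \<open>
  An element of \<open>k[X, z\<^sup>\<plusminus>\<^sup>1] \<oplus> k C\<close> is a pair: a finitely supported family of
  polynomials in \<open>X\<close>, indexed by the exponent of \<open>z\<close>, and the coefficient of \<open>C\<close>.
\<close>

type_synonym 'a frobW = "(int \<Rightarrow>\<^sub>0 'a poly) \<times> 'a"

definition frobW_scale :: "'a::field \<Rightarrow> 'a frobW \<Rightarrow> 'a frobW" where
  "frobW_scale c x = (Poly_Mapping.map (smult c) (fst x), c * snd x)"

definition frobW_monom :: "'a::field poly \<Rightarrow> int \<Rightarrow> 'a frobW" where
  "frobW_monom f n = (Poly_Mapping.single n f, 0)"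

definition frobW_C :: "'a::field frobW" where
  "frobW_C = (0, 1)"

text \<open>
  \<open>in_square p\<close> is the polynomial \<open>q\<close> with \<open>p(T) = q(T\<^sup>2)\<close>, for a polynomial \<open>p\<close> in the square
  of its variable.
\<close>

definition in_square :: "'b::comm_ring_1 poly \<Rightarrow> 'b poly" where
  "in_square p = (THE q. pcompose q (monom 1 2) = p)"

text \<open>
  Polynomials in \<open>X\<close> and \<open>Y\<close> are polynomials in \<open>Y\<close> with coefficients in \<open>k[X]\<close>, so that
  \<open>subst_X_plus f c\<close> is \<open>f(X + c Y)\<close>.
\<close>

definition subst_X_plus :: "'a::field poly \<Rightarrow> 'a \<Rightarrow> 'a poly poly" where
  "subst_X_plus f c = poly (map_poly (\<lambda>a. [:[:a:]:]) f) [:[:0, 1:], [:c:]:]"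

definition star :: "int \<Rightarrow> int \<Rightarrow> 'a::field poly \<Rightarrow> 'a poly \<Rightarrow> 'a poly" where
  "star m n f g =
     (let a = of_int m / 2; b = of_int n / 2;
          numer = subst_X_plus f b * subst_X_plus g (- a) - subst_X_plus f (- b) * subst_X_plus g a
      in poly (in_square (numer div [:0, 1:])) 1)"

text \<open>\<open>sub_sum m f\<close> is the polynomial \<open>f\<^sub>(\<^sub>m\<^sub>)\<close>.\<close>

definition sub_sum :: "nat \<Rightarrow> 'a::field poly \<Rightarrow> 'a poly" where
  "sub_sum m f = in_square (\<Sum>j = 1..m. pcompose f [:0, of_int (int m + 1 - 2 * int j) / 2:])"

definition Psi :: "'a::field poly \<Rightarrow> int \<Rightarrow> 'a poly \<Rightarrow> int \<Rightarrow> 'a" where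
  "Psi f m g n =
     (if m = - n
      then if m \<ge> 0 then poly (sub_sum (nat m) (f * g)) 1 else - poly (sub_sum (nat n) (f * g)) 1
      else 0)"

definition frobW_bracket :: "'a::field frobW \<Rightarrow> 'a frobW \<Rightarrow> 'a frobW" where
  "frobW_bracket x y =
     (let p = Poly_Mapping.lookup (fst x); q = Poly_Mapping.lookup (fst y) in
      \<Sum>m \<in> Poly_Mapping.keys (fst x). \<Sum>n \<in> Poly_Mapping.keys (fst y).
        frobW_monom (star m n (p m) (q n)) (m + n) + frobW_scale (Psi (p m) m (q n) n) frobW_C)"


section \<open>The Lie algebra \<open>W\<^sub>1\<^sub>+\<^sub>\<infinity>\<close>\<close>

datatype winf_basis = Cw | Ww int nat

type_synonym 'a winf = "winf_basis \<Rightarrow>\<^sub>0 'a"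

definition winf_scale :: "'a::field_char_0 \<Rightarrow> 'a winf \<Rightarrow> 'a winf" where
  "winf_scale c = Poly_Mapping.map ((*) c)"

definition winf_C :: "'a::field_char_0 winf" where
  "winf_C = Poly_Mapping.single Cw 1"

definition winf_monom :: "'a::field_char_0 poly \<Rightarrow> int \<Rightarrow> 'a winf" where
  "winf_monom f n = (\<Sum>r\<le>degree f. Poly_Mapping.single (Ww n r) (coeff f r))"

text \<open>
  Power series in \<open>u\<close> and \<open>v\<close> over \<open>R\<close> have type \<open>R fps fps\<close>; the coefficient of \<open>u\<^sup>r v\<^sup>s\<close> is
  \<open>fps_nth (fps_nth F r) s\<close>. The series \<open>exp2 sc a b\<close> is \<open>exp(a u + b v)\<close>,
  where \<open>sc\<close> is the action of the field on \<open>R\<close>, which is \<open>k\<close> or \<open>k[D]\<close>.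
\<close>

definition exp2 :: "('a::field_char_0 \<Rightarrow> 'r \<Rightarrow> 'r) \<Rightarrow> 'r::comm_ring_1 \<Rightarrow> 'r \<Rightarrow> 'r fps fps" where
  "exp2 sc a b = Abs_fps (\<lambda>r. Abs_fps (\<lambda>s. sc (1 / (fact r * fact s)) (a ^ r * b ^ s)))"

definition winf_main_series :: "int \<Rightarrow> int \<Rightarrow> 'a::field_char_0 poly fps fps" where
  "winf_main_series m n =
     (exp2 smult (of_int n) 0 - exp2 smult 0 (of_int m)) * exp2 smult [:0, 1:] [:0, 1:]"

text \<open>
  For \<open>m = -n\<close> the numerator is divisible by \<open>1 - exp(u + v)\<close>. Since the latter is not a unit, the
  quotient is the series whose product with it is the numerator.
\<close>

definition winf_central_series :: "int \<Rightarrow> int \<Rightarrow> 'a::field_char_0 fps fps" where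
  "winf_central_series m n =
     (if m = - n
      then THE q. q * (1 - exp2 (*) 1 1) = exp2 (*) (of_int (- m)) 0 - exp2 (*) 0 (of_int (- n))
      else 0)"

text \<open>
  As \<open>w\<^sub>m\<^sub>,\<^sub>r = D\<^sup>r z\<^sup>m\<close> is \<open>r!\<close> times the coefficient of \<open>u\<^sup>r\<close> in \<open>exp(u D) z\<^sup>m\<close>,
  the bracket of \<open>w\<^sub>m\<^sub>,\<^sub>r\<close> and \<open>w\<^sub>n\<^sub>,\<^sub>s\<close> is \<open>r! s!\<close> times the coefficient of \<open>u\<^sup>r v\<^sup>s\<close> in the generating
  series for the bracket of \<open>exp(u D) z\<^sup>m\<close> and \<open>exp(v D) z\<^sup>n\<close>.
\<close>

fun winf_basis_bracket :: "winf_basis \<Rightarrow> winf_basis \<Rightarrow> 'a::field_char_0 winf" where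
  "winf_basis_bracket (Ww m r) (Ww n s) =
     winf_scale (fact r * fact s)
       (winf_monom (fps_nth (fps_nth (winf_main_series m n) r) s) (m + n)
        + winf_scale (fps_nth (fps_nth (winf_central_series m n) r) s) winf_C)"
| "winf_basis_bracket _ _ = 0"

definition winf_bracket :: "'a::field_char_0 winf \<Rightarrow> 'a winf \<Rightarrow> 'a winf" where
  "winf_bracket x y =
     (\<Sum>b \<in> Poly_Mapping.keys x. \<Sum>c \<in> Poly_Mapping.keys y.
        winf_scale (Poly_Mapping.lookup x b * Poly_Mapping.lookup y c) (winf_basis_bracket b c))"


section \<open>The comparison map\<close>

definition is_comparison_map :: "('a::field_char_0 frobW \<Rightarrow> 'a winf) \<Rightarrow> bool" where
  "is_comparison_map \<phi> \<longleftrightarrow>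
     Vector_Spaces.linear frobW_scale winf_scale \<phi> \<and>
     (\<forall>r n. \<phi> (frobW_monom (monom 1 r) n) = winf_monom ([:of_int (n + 1) / 2, 1:] ^ r) n) \<and>
     \<phi> frobW_C = winf_C"

end

theory Submission
  imports Defs
begin

text \<open>
  Extracting coefficients from the generating series gives
  \<open>[F(D)z\<^sup>m, G(D)z\<^sup>n] = (F(D + n)G(D) - F(D)G(D + m))z\<^sup>m\<^sup>+\<^sup>n + \<psi> C\<close>, where for \<open>m = - n\<close> the
  scalar \<open>\<psi>\<close> is the sum of \<open>F(k - m)G(k)\<close> over \<open>0 \<le> k < m\<close>, read as minus the sum over
  \<open>m \<le> k < 0\<close> when \<open>m\<close> is negative. Substituting \<open>X = D + (n + 1)/2\<close> turns the product
  \<open>star\<close> and the cocycle \<open>Psi\<close> into these expressions. The Jacobi identity is checked for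
  \<open>W\<^sub>1\<^sub>+\<^sub>\<infinity>\<close>, where the polynomial part is a commutator of difference operators and the cocycle
  identity is additivity of oriented sums; it is then pulled back along the bijective comparison map.
\<close>

section \<open>Oriented sums over the integers\<close>

text \<open>A discrete integral from 0 to \<open>m\<close>: at most one of the two intervals is
  nonempty, so the sign cases of \<open>Psi\<close> merge into one formula.\<close>

definition isum :: "int \<Rightarrow> (int \<Rightarrow> 'b::ab_group_add) \<Rightarrow> 'b" where
  "isum m P = sum P {0..<m} - sum P {m..<0}"

lemma isum_0 [simp]: "isum 0 P = 0"
  by (simp add: isum_def)

lemma isum_Suc: "isum (m + 1) P = isum m P + P m"
proof (cases "m \<ge> 0")
  case True
  then have "{0..<m + 1} = insert m {0..<m}" by auto
  with True show ?thesis by (simp add: isum_def)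
next
  case False
  then have "{m..<0} = insert m {m + 1..<0}" by auto
  with False show ?thesis by (simp add: isum_def)
qed

lemma isum_pred: "isum (m - 1) P = isum m P - P (m - 1)"
  using isum_Suc[of "m - 1" P] by simp

text \<open>The oriented intervals from 0 to \<open>m\<close> and from \<open>m\<close> to
  \<open>m + n\<close> concatenate whatever the signs; the second is translated back to start at
  0.\<close>

lemma isum_split: "isum (m + n) P = isum m P + isum n (\<lambda>k. P (k + m))"
proof (induction n rule: int_induct[where k = 0])
  case base
  show ?case by simp
next
  case (step1 i)
  then show ?case
    using isum_Suc[of "m + i" P] isum_Suc[of i "\<lambda>k. P (k + m)"] by (simp add: add_ac)
next
  case (step2 i)
  have "m + (i - 1) = m + i - 1" by simp
  then have "isum (m + (i - 1)) P = isum (m + i) P - P (m + i - 1)"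
    by (simp only: isum_pred)
  then show ?case
    by (simp only: step2 isum_pred) (simp add: algebra_simps)
qed

lemma isum_uminus_shift: "isum (- m) (\<lambda>k. P (k + m)) = - isum m P"
  using isum_split[of m "- m" P] by (simp add: eq_neg_iff_add_eq_0 add.commute)

lemma isum_add: "isum m (\<lambda>k. P k + Q k) = isum m P + isum m Q"
  by (simp add: isum_def sum.distrib)

lemma isum_diff: "isum m (\<lambda>k. P k - Q k) = isum m P - isum m Q"
  by (simp add: isum_def sum_subtractf)

text \<open>Serves to divide by 1 - exp(u + v): multiplication by that factor turns a geometric sum
  into differences of this form.\<close>

lemma isum_telescope: "isum m (\<lambda>k. P k - P (k + 1)) = P 0 - P m"
proof (induction m rule: int_induct[where k = 0])
  case base
  show ?case by simp
next
  case (step1 i)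
  then show ?case by (simp add: isum_Suc)
next
  case (step2 i)
  then show ?case by (simp add: isum_pred)
qed

lemma isum_additive:
  assumes "\<And>x y. f (x + y) = f x + f y"
  shows "f (isum m P) = isum m (\<lambda>k. f (P k))"
proof -
  interpret additive f by standard (rule assms)
  show ?thesis by (simp add: isum_def diff sum)
qed


section \<open>Polynomials\<close>

lemma poly_induct_monom_add [case_names monom add]:
  assumes "\<And>a r. P (monom a r)" "\<And>p q. P p \<Longrightarrow> P q \<Longrightarrow> P (p + q)"
  shows "P p"
proof -
  have "P (\<Sum>i\<in>A. monom (coeff p i) i)" if "finite A" for A
    using that
  proof induction
    case empty
    show ?case using assms(1)[of 0 0] by simp
  qed (simp add: assms)
  from this[of "{..degree p}"] show ?thesis by (simp add: poly_as_sum_of_monoms)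
qed

text \<open>The even positions determine \<open>q\<close>, which gives the uniqueness behind the
  definite description in \<open>in_square\<close>.\<close>

lemma coeff_pcompose_square:
  fixes q :: "'b::comm_ring_1 poly"
  shows "coeff (pcompose q (monom 1 2)) i = (if even i then coeff q (i div 2) else 0)"
proof (induction q arbitrary: i)
  case 0
  show ?case by simp
next
  case (pCons a q)
  consider "i = 0" | "i = 1" | j where "i = Suc (Suc j)"
    by (metis One_nat_def not0_implies_Suc)
  then show ?case
    by cases (auto simp: pcompose_pCons pCons.IH coeff_monom_mult)
qed

lemma in_square_eqI:
  assumes "pcompose q (monom 1 2) = p"
  shows "in_square p = q"
  unfolding in_square_def
proof (rule the_equality)
  fix q'
  assume "pcompose q' (monom 1 2) = p"
  then show "q' = q"
    using assms coeff_pcompose_square[of q "2 * i" for i] coeff_pcompose_square[of q' "2 * i" for i]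
    by (auto intro!: poly_eqI)
qed (fact assms)

text \<open>Since 1 is its own square, the value at T^2 = 1 is the value at T = 1 once only even
  powers of T occur.\<close>

lemma poly_in_square_1:
  fixes p :: "'b::comm_ring_1 poly"
  assumes "\<And>i. odd i \<Longrightarrow> coeff p i = 0"
  shows "poly (in_square p) 1 = poly p 1"
proof -
  \<comment> \<open>The bound \<open>degree p\<close> overshoots, but the coefficients
    \<open>coeff p (2 * i)\<close> beyond the degree vanish.\<close>
  define q where "q = (\<Sum>i\<le>degree p. monom (coeff p (2 * i)) i)"
  have "coeff q i = coeff p (2 * i)" for i
    unfolding q_def by (auto simp: coeff_sum coeff_eq_0)
  then have q: "pcompose q (monom 1 2) = p"
    using assms by (auto intro!: poly_eqI simp: coeff_pcompose_square)
  have "poly p 1 = poly q 1"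
    by (simp flip: q add: poly_pcompose poly_monom)
  then show ?thesis by (simp add: in_square_eqI[OF q])
qed

lemma coeff_pcompose_uminus:
  fixes p :: "'b::comm_ring_1 poly"
  shows "coeff (pcompose p [:0, - 1:]) i = (- 1) ^ i * coeff p i"
proof (induction p arbitrary: i)
  case (pCons a p)
  then show ?case by (cases i) (auto simp: pcompose_pCons)
qed simp

text \<open>The substitution of -T for T multiplies the coefficient of T^i by (-1)^i; for odd i
  invariance makes it equal to its own negative, hence zero in characteristic zero.\<close>

lemma coeff_even_poly_odd:
  fixes p :: "'b::{idom, ring_char_0} poly"
  assumes "pcompose p [:0, - 1:] = p" "odd i"
  shows "coeff p i = 0"
proof -
  have "coeff p i = - coeff p i"
    using coeff_pcompose_uminus[of p i] assms by simp
  then show ?thesis by simp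
qed

lemma coeff_odd_poly_even:
  fixes p :: "'b::{idom, ring_char_0} poly"
  assumes "pcompose p [:0, - 1:] = - p" "even i"
  shows "coeff p i = 0"
proof -
  have "- coeff p i = coeff p i"
    using coeff_pcompose_uminus[of p i] assms by simp
  then show ?thesis by simp
qed

section \<open>Closed forms of the product \<open>star\<close> and of \<open>Psi\<close>\<close>

lemma subst_X_plus_0 [simp]: "subst_X_plus 0 c = 0"
  by (simp add: subst_X_plus_def)

lemma subst_X_plus_pCons:
  "subst_X_plus (pCons a f) c = [:[:a:]:] + [:[:0, 1:], [:c:]:] * subst_X_plus f c"
  by (simp add: subst_X_plus_def map_poly_pCons)

text \<open>Replacing Y by -Y thus exchanges the two products in the numerator of
  \<open>star\<close>.\<close>

lemma pcompose_subst_X_plus: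
  "pcompose (subst_X_plus f c) [:0, - 1:] = subst_X_plus f (- c)"
  by (induction f) (simp_all add: subst_X_plus_pCons pcompose_add pcompose_mult pcompose_smult pcompose_pCons
        flip: smult_minus_left)

lemma poly_subst_X_plus_1: "poly (subst_X_plus f c) 1 = pcompose f [:c, 1:]"
  by (induction f) (simp_all add: subst_X_plus_pCons pcompose_pCons)

text \<open>Since the quotient lies in \<open>k[X][Y\<^sup>2]\<close>, setting \<open>Y\<^sup>2 = 1\<close> amounts to setting \<open>Y = 1\<close>.\<close>

lemma star_eq:
  fixes f g :: "'a::field_char_0 poly"
  shows "star m n f g =
    pcompose f [:of_int n / 2, 1:] * pcompose g [:- (of_int m / 2), 1:]
    - pcompose f [:- (of_int n / 2), 1:] * pcompose g [:of_int m / 2, 1:]"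
proof -
  define a b :: 'a where "a = of_int m / 2" and "b = of_int n / 2"
  define N where "N = subst_X_plus f b * subst_X_plus g (- a) - subst_X_plus f (- b) * subst_X_plus g a"
  \<comment> \<open>Being odd in Y, the numerator has no constant term; it is Y times
    \<open>h\<close>, and \<open>h\<close> is even in Y.\<close>
  have odd: "pcompose N [:0, - 1:] = - N"
    by (simp add: N_def pcompose_diff pcompose_mult pcompose_subst_X_plus)
  have "coeff N 0 = 0"
    using coeff_odd_poly_even[OF odd, of 0] by simp
  then obtain h where N: "N = pCons 0 h"
    by (metis pCons_cases coeff_pCons_0)
  have div: "N div [:0, 1:] = h"
    using nonzero_mult_div_cancel_left[of "[:0, 1:] :: 'a poly poly" h] by (simp add: N)
  have "coeff h i = 0" if "odd i" for i
    using coeff_odd_poly_even[OF odd, of "Suc i"] that by (simp add: N)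
  then have "poly (in_square h) 1 = poly h 1"
    by (rule poly_in_square_1)
  also have "\<dots> = poly N 1" by (simp add: N)
  finally show ?thesis
    unfolding star_def Let_def a_def[symmetric] b_def[symmetric] N_def[symmetric] div
    by (simp add: N_def poly_subst_X_plus_1)
qed

text \<open>The nodes (m + 1 - 2j)/2 are symmetric about 0 under j -> m + 1 - j, so the sum is an
  even polynomial and may be evaluated at X = 1.\<close>

lemma poly_sub_sum_1:
  fixes f :: "'a::field_char_0 poly"
  shows "poly (sub_sum m f) 1 = (\<Sum>j = 1..m. poly f (of_int (int m + 1 - 2 * int j) / 2))"
proof -
  define c :: "nat \<Rightarrow> 'a" where "c = (\<lambda>j. of_int (int m + 1 - 2 * int j) / 2)"
  define p where "p = (\<Sum>j = 1..m. pcompose f [:0, c j:])"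
  have "pcompose p [:0, - 1:] = (\<Sum>j = 1..m. pcompose f [:0, - c j:])"
    by (simp add: p_def pcompose_sum pcompose_pCons flip: pcompose_assoc)
  also have "\<dots> = p"
  proof -
    have "c (m + 1 - j) = - c j" if "j \<le> m" for j
      using that by (simp add: c_def of_nat_diff field_simps)
    then show ?thesis
      unfolding p_def
      by (intro sum.reindex_bij_witness[of _ "\<lambda>j. m + 1 - j" "\<lambda>j. m + 1 - j"]) auto
  qed
  finally have "poly (in_square p) 1 = poly p 1"
    by (intro poly_in_square_1 coeff_even_poly_odd)
  then show ?thesis
    by (simp add: sub_sum_def p_def c_def poly_sum poly_pcompose)
qed

text \<open>Relabelling by j = m - k for \<open>m \<ge> 0\<close> and by j = -k for negative
  \<open>m\<close> turns the node of index j into k + (1 - m)/2 in both cases.\<close>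

lemma Psi_eq:
  fixes f g :: "'a::field_char_0 poly"
  shows "Psi f m g n =
    (if m = - n then isum m (\<lambda>k. poly (f * g) (of_int k + of_int (1 - m) / 2)) else 0)"
proof (cases "m \<ge> 0")
  case True
  then have "(\<Sum>j = 1..nat m. poly (f * g) (of_int (int (nat m) + 1 - 2 * int j) / 2))
      = (\<Sum>k\<in>{0..<m}. poly (f * g) (of_int k + of_int (1 - m) / 2))"
    by (intro sum.reindex_bij_witness[of _ "\<lambda>k. nat (m - k)" "\<lambda>j. m - int j"])
       (auto simp: field_simps)
  with True show ?thesis
    by (cases "m = - n") (simp_all only: Psi_def poly_sub_sum_1 isum_def, simp_all)
next
  case False
  then have "(\<Sum>j = 1..nat (- m). poly (f * g) (of_int (int (nat (- m)) + 1 - 2 * int j) / 2))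
      = (\<Sum>k\<in>{m..<0}. poly (f * g) (of_int k + of_int (1 - m) / 2))"
    by (intro sum.reindex_bij_witness[of _ "\<lambda>k. nat (- k)" "\<lambda>j. - int j"])
       (auto simp: field_simps)
  with False show ?thesis
    by (cases "m = - n") (simp_all only: Psi_def poly_sub_sum_1 isum_def, simp_all)
qed


section \<open>The generating series of the bracket of \<open>W\<^sub>1\<^sub>+\<^sub>\<infinity>\<close>\<close>

text \<open>The binomial theorem in both variables. The map \<open>h\<close> embeds the scalars into
  the coefficient ring, which treats k and k[D] together.\<close>

lemma exp2_mult:
  fixes sc :: "'a::field_char_0 \<Rightarrow> 'r \<Rightarrow> 'r::comm_ring_1"
  assumes sc: "\<And>c y. sc c y = h c * y"
    and mult: "\<And>x y. h (x * y) = h x * h y"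
    and of_nat: "\<And>n. h (of_nat n) = of_nat n"
  shows "exp2 sc a b * exp2 sc c d = exp2 sc (a + c) (b + d)"
proof (rule fps_ext, rule fps_ext)
  fix r s
  \<comment> \<open>The factorials of complementary indices combine to binomial coefficients over r!
    s!, and \<open>h\<close> carries this identity over.\<close>
  have fact: "h (1 / (fact i * fact j)) * h (1 / (fact (r - i) * fact (s - j)))
      = h (1 / (fact r * fact s)) * (of_nat (r choose i) * of_nat (s choose j))"
    if "i \<le> r" "j \<le> s" for i j
  proof -
    have "1 / (fact i * fact j) * (1 / (fact (r - i) * fact (s - j)))
        = 1 / (fact r * fact s) * (of_nat (r choose i) * of_nat (s choose j) :: 'a)"
      using that by (simp add: binomial_fact field_simps)
    then show ?thesis by (metis mult of_nat)
  qed
  have "fps_nth (fps_nth (exp2 sc a b * exp2 sc c d) r) s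
      = (\<Sum>i\<le>r. \<Sum>j\<le>s. h (1 / (fact i * fact j)) * (a ^ i * b ^ j) *
          (h (1 / (fact (r - i) * fact (s - j))) * (c ^ (r - i) * d ^ (s - j))))"
    by (simp add: fps_mult_nth fps_sum_nth exp2_def sc atLeast0AtMost)
  also have "\<dots> = (\<Sum>i\<le>r. \<Sum>j\<le>s. h (1 / (fact r * fact s)) *
      ((of_nat (r choose i) * a ^ i * c ^ (r - i)) * (of_nat (s choose j) * b ^ j * d ^ (s - j))))"
  proof (intro sum.cong refl)
    fix i j
    assume "i \<in> {..r}" "j \<in> {..s}"
    then have "i \<le> r" "j \<le> s" by simp_all
    have "h (1 / (fact i * fact j)) * (a ^ i * b ^ j) *
          (h (1 / (fact (r - i) * fact (s - j))) * (c ^ (r - i) * d ^ (s - j)))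
        = h (1 / (fact i * fact j)) * h (1 / (fact (r - i) * fact (s - j))) *
          (a ^ i * b ^ j * (c ^ (r - i) * d ^ (s - j)))"
      by (simp only: ac_simps)
    also have "\<dots> = h (1 / (fact r * fact s)) * (of_nat (r choose i) * of_nat (s choose j)) *
          (a ^ i * b ^ j * (c ^ (r - i) * d ^ (s - j)))"
      by (simp only: fact[OF \<open>i \<le> r\<close> \<open>j \<le> s\<close>])
    finally show "h (1 / (fact i * fact j)) * (a ^ i * b ^ j) *
          (h (1 / (fact (r - i) * fact (s - j))) * (c ^ (r - i) * d ^ (s - j)))
        = h (1 / (fact r * fact s)) *
      ((of_nat (r choose i) * a ^ i * c ^ (r - i)) * (of_nat (s choose j) * b ^ j * d ^ (s - j)))"
      by (simp only: ac_simps)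
  qed
  also have "\<dots> = h (1 / (fact r * fact s)) * ((a + c) ^ r * (b + d) ^ s)"
    unfolding binomial_ring sum_product by (simp add: sum_distrib_left)
  finally show "fps_nth (fps_nth (exp2 sc a b * exp2 sc c d) r) s
      = fps_nth (fps_nth (exp2 sc (a + c) (b + d)) r) s"
    by (simp add: exp2_def sc)
qed

lemma exp2_smult_mult: "exp2 smult a b * exp2 smult c d = exp2 smult (a + c) (b + d)"
  by (rule exp2_mult[where h = "\<lambda>c. [:c:]"]) (simp_all add: of_nat_poly)

lemma exp2_times_mult: "exp2 (*) a b * exp2 (*) c d = exp2 (*) (a + c) (b + d)"
  by (rule exp2_mult[where h = "\<lambda>c. c"]) simp_all

text \<open>Exponents add: exp(nu) exp(uD + vD) = exp(u(D + n) + vD), and likewise exp(mv) shifts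
  the D attached to v.\<close>

lemma winf_main_series_nth:
  "fps_nth (fps_nth (winf_main_series m n) r) s =
    smult (1 / (fact r * fact s))
      ([:of_int n, 1:] ^ r * [:0, 1:] ^ s - [:0, 1:] ^ r * [:of_int m, 1:] ^ s)"
  by (simp add: winf_main_series_def left_diff_distrib exp2_smult_mult)
     (simp add: exp2_def smult_diff_right of_int_poly)

text \<open>A geometric sum: multiplying exp((k - m)u + kv) by 1 - exp(u + v) gives the difference
  of consecutive terms. The sum telescopes to exp(-mu) - exp(mv), and the quotient is unique in a
  domain.\<close>

lemma winf_central_series_eq:
  assumes "m = - n"
  shows "winf_central_series m n = isum m (\<lambda>k. exp2 (*) (of_int (k - m)) (of_int k))"
proof -
  let ?E = "\<lambda>k. exp2 (*) (of_int (k - m)) (of_int k) :: 'a fps fps"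
  let ?e = "1 - exp2 (*) 1 1 :: 'a fps fps"
  \<comment> \<open>The coefficient of uv in 1 - exp(u + v) is -1.\<close>
  have ne: "?e \<noteq> 0"
  proof
    assume "?e = 0"
    then have "fps_nth (fps_nth ?e 1) 1 = 0" by simp
    then show False by (simp add: exp2_def)
  qed
  have "isum m ?E * ?e = isum m (\<lambda>k. ?E k * ?e)"
    by (rule isum_additive) (simp add: distrib_right)
  also have "(\<lambda>k. ?E k * ?e) = (\<lambda>k. ?E k - ?E (k + 1))"
    by (simp add: right_diff_distrib exp2_times_mult algebra_simps)
  also have "isum m (\<lambda>k. ?E k - ?E (k + 1)) = ?E 0 - ?E m"
    by (rule isum_telescope)
  finally have *: "isum m ?E * ?e = exp2 (*) (of_int (- m)) 0 - exp2 (*) 0 (of_int (- n))"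
    using assms by simp
  have "(THE q. q * ?e = exp2 (*) (of_int (- m)) 0 - exp2 (*) 0 (of_int (- n))) = isum m ?E"
  proof (rule the_equality)
    fix q
    assume "q * ?e = exp2 (*) (of_int (- m)) 0 - exp2 (*) 0 (of_int (- n))"
    then have "q * ?e = isum m ?E * ?e" by (simp only: *)
    then show "q = isum m ?E" using ne by (simp only: mult_cancel_right) simp
  qed (fact *)
  then show ?thesis using assms by (simp add: winf_central_series_def)
qed

lemma winf_central_series_nth:
  "fps_nth (fps_nth (winf_central_series m n) r) s =
    (if m = - n
     then isum m (\<lambda>k. of_int (k - m) ^ r * of_int k ^ s) / (fact r * fact s) else 0)"
proof (cases "m = - n")
  case True
  have "fps_nth (fps_nth (winf_central_series m n) r) s
      = isum m (\<lambda>k. (of_int (k - m) ^ r * of_int k ^ s) / (fact r * fact s))"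
    unfolding winf_central_series_eq[OF True]
    by (subst isum_additive[where f = "\<lambda>F. fps_nth (fps_nth F r) s"])
       (simp_all add: exp2_def)
  also have "\<dots> = isum m (\<lambda>k. of_int (k - m) ^ r * of_int k ^ s) / (fact r * fact s)"
    by (rule isum_additive[symmetric]) (simp add: add_divide_distrib)
  finally show ?thesis using True by simp
qed (simp add: winf_central_series_def)


section \<open>The bracket of \<open>W\<^sub>1\<^sub>+\<^sub>\<infinity>\<close> on \<open>k[D]z\<^sup>n\<close>\<close>

lemma pcompose_translate:
  "pcompose (pcompose f [:a, 1:]) [:b, 1:] = pcompose f [:a + b, 1:]"
  for f :: "'a::comm_ring_1 poly"
  by (simp add: pcompose_pCons add.commute flip: pcompose_assoc)

lemma pcompose_power: "pcompose (p ^ r) q = pcompose p q ^ r"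
  for p :: "'a::comm_ring_1 poly"
  by (induction r) (simp_all add: pcompose_1 pcompose_mult)

definition shift :: "int \<Rightarrow> 'a::comm_ring_1 poly \<Rightarrow> 'a poly" where
  "shift n F = pcompose F [:of_int n, 1:]"

lemma poly_shift: "poly (shift n F) x = poly F (of_int n + x)"
  by (simp add: shift_def poly_pcompose)

lemma shift_shift: "shift m (shift n F) = shift (m + n) F"
  by (simp add: shift_def pcompose_translate add.commute)

lemma shift_add: "shift n (F + G) = shift n F + shift n G"
  by (simp add: shift_def pcompose_add)

lemma shift_diff: "shift n (F - G) = shift n F - shift n G"
  by (simp add: shift_def pcompose_diff)

lemma shift_mult: "shift n (F * G) = shift n F * shift n G"
  by (simp add: shift_def pcompose_mult)

text \<open>The commutator of the operators z^m F(D) and z^n G(D) under the rule F(D) z^n = z^n F(D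
  + n).\<close>

definition comm_part :: "'a::comm_ring_1 poly \<Rightarrow> int \<Rightarrow> 'a poly \<Rightarrow> int \<Rightarrow> 'a poly" where
  "comm_part F m G n = shift n F * G - F * shift m G"

text \<open>The standard cocycle of \<open>W\<^sub>1\<^sub>+\<^sub>\<infinity>\<close>: with j = k -
  m and m > 0 it is the sum of F(j) G(j + m) over -m \<le> j < 0.\<close>

definition cocycle :: "'a::comm_ring_1 poly \<Rightarrow> int \<Rightarrow> 'a poly \<Rightarrow> int \<Rightarrow> 'a" where
  "cocycle F m G n =
     (if m = - n then isum m (\<lambda>k. poly F (of_int (k - m)) * poly G (of_int k)) else 0)"

lemma comm_part_add_left: "comm_part (F + F') m G n = comm_part F m G n + comm_part F' m G n"
  by (simp add: comm_part_def shift_add algebra_simps)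

lemma comm_part_add_right: "comm_part F m (G + G') n = comm_part F m G n + comm_part F m G' n"
  by (simp add: comm_part_def shift_add algebra_simps)

lemma comm_part_antisym: "comm_part F m G n = - comm_part G n F m"
  by (simp add: comm_part_def algebra_simps)

text \<open>Shifts are commuting ring homomorphisms, so the underlying operator product is
  associative and the terms of the nested commutators cancel in pairs.\<close>

lemma comm_part_jacobi:
  "comm_part F m (comm_part G n H p) (n + p) + comm_part G n (comm_part H p F m) (p + m)
    + comm_part H p (comm_part F m G n) (m + n) = 0"
  by (simp add: comm_part_def shift_diff shift_mult shift_shift algebra_simps)

lemma cocycle_add_left: "cocycle (F + F') m G n = cocycle F m G n + cocycle F' m G n"
  by (simp add: cocycle_def distrib_right isum_add)

lemma cocycle_add_right: "cocycle F m (G + G') n = cocycle F m G n + cocycle F m G' n"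
  by (simp add: cocycle_def distrib_left isum_add)

text \<open>Translating k by \<open>m\<close> swaps the roles of \<open>F\<close> and
  \<open>G\<close> and reverses the orientation of the sum.\<close>

lemma cocycle_antisym: "cocycle F m G n = - cocycle G n F m"
proof (cases "m = - n")
  case True
  then show ?thesis
    using isum_uminus_shift[of m "\<lambda>k. poly F (of_int (k - m)) * poly G (of_int k)"]
    by (simp add: cocycle_def mult.commute)
qed (auto simp: cocycle_def)

text \<open>
  With \<open>A k = F(k - m) G(k + p) H(k)\<close> and \<open>B k = F(k + p) G(k - n) H(k)\<close>, the three terms are
  oriented sums of translates of \<open>A - B\<close> over consecutive intervals, which cancel.
\<close>

lemma cocycle_jacobi:
  "cocycle (comm_part F m G n) (m + n) H p + cocycle (comm_part G n H p) (n + p) F m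
    + cocycle (comm_part H p F m) (p + m) G n = 0"
proof (cases "p = - m - n")
  case True
  define A where "A = (\<lambda>k. poly F (of_int (k - m)) * poly G (of_int (k + p)) * poly H (of_int k))"
  define B where "B = (\<lambda>k. poly F (of_int (k + p)) * poly G (of_int (k - n)) * poly H (of_int k))"
  have 1: "cocycle (comm_part F m G n) (m + n) H p = isum (m + n) A - isum (m + n) B"
    by (simp add: cocycle_def comm_part_def True A_def B_def poly_shift flip: isum_diff)
       (simp add: algebra_simps)
  have 2: "cocycle (comm_part G n H p) (n + p) F m =
      isum (- m) (\<lambda>k. A (k + m)) - isum (- m) (\<lambda>k. B (k + (m + n)))"
    by (simp add: cocycle_def comm_part_def True A_def B_def poly_shift flip: isum_diff)
       (simp add: algebra_simps)
  have 3: "cocycle (comm_part H p F m) (p + m) G n =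
      isum (- n) (\<lambda>k. A (k + (m + n))) - isum (- n) (\<lambda>k. B (k + n))"
    by (simp add: cocycle_def comm_part_def True A_def B_def poly_shift flip: isum_diff)
       (simp add: algebra_simps)
  \<comment> \<open>The sums of \<open>A\<close> run from 0 to m + n, from m + n to m and from m to
    0; those of \<open>B\<close> from 0 to m + n, from m + n to n and from n to 0. Both loops
    close.\<close>
  show ?thesis
    unfolding 1 2 3
    using isum_split[of "m + n" "- n" A] isum_split[of "m + n" "- m" B]
    by (simp add: isum_uminus_shift)
qed (auto simp: cocycle_def)

section \<open>Generators of \<open>W\<^sub>1\<^sub>+\<^sub>\<infinity>\<close> and bilinearity of
  its bracket\<close>

lemma lookup_winf_scale [simp]:
  "Poly_Mapping.lookup (winf_scale c x) b = c * Poly_Mapping.lookup x b"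
  by (simp add: winf_scale_def Poly_Mapping.map.rep_eq when_def)

interpretation winf: vector_space winf_scale
  by standard (auto intro!: poly_mapping_eqI simp: lookup_add algebra_simps)

lemma lookup_winf_monom:
  "Poly_Mapping.lookup (winf_monom f n) b =
    (case b of Cw \<Rightarrow> 0 | Ww m r \<Rightarrow> if m = n then coeff f r else 0)"
  by (auto simp: winf_monom_def lookup_sum lookup_single when_def coeff_eq_0 split: winf_basis.split)

lemma lookup_winf_C: "Poly_Mapping.lookup winf_C b = (if b = Cw then 1 else 0)"
  by (auto simp: winf_C_def lookup_single when_def)

lemma winf_monom_0 [simp]: "winf_monom 0 n = 0"
  by (auto intro!: poly_mapping_eqI simp: lookup_winf_monom split: winf_basis.split)

lemma winf_monom_add: "winf_monom (f + g) n = winf_monom f n + winf_monom g n"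
  by (auto intro!: poly_mapping_eqI simp: lookup_winf_monom lookup_add split: winf_basis.split)

lemma winf_monom_smult: "winf_monom (smult c f) n = winf_scale c (winf_monom f n)"
  by (auto intro!: poly_mapping_eqI simp: lookup_winf_monom split: winf_basis.split)

lemma winf_monom_uminus: "winf_monom (- f) n = - winf_monom f n"
  using winf_monom_smult[of "- 1" f n] by simp

lemma single_Ww: "Poly_Mapping.single (Ww n r) c = winf_monom (monom c r) n"
  by (auto intro!: poly_mapping_eqI simp: lookup_winf_monom lookup_single when_def
      split: winf_basis.split)

lemma single_Cw: "Poly_Mapping.single Cw c = winf_scale c winf_C"
  by (auto intro!: poly_mapping_eqI simp: lookup_winf_C lookup_single when_def)

lemma poly_mapping_eq_sum_single:
  "x = (\<Sum>b\<in>Poly_Mapping.keys x. Poly_Mapping.single b (Poly_Mapping.lookup x b))"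
  by (rule poly_mapping_eqI)
     (auto simp: lookup_sum lookup_single when_def in_keys_iff)

text \<open>Reduces additive claims to multiples of C and to F(D)z^n with arbitrary
  \<open>F\<close>, the elements for which the closed bracket formula is available.\<close>

lemma winf_induct [case_names monom C add]:
  assumes monom: "\<And>F n. P (winf_monom F n)"
    and C: "\<And>c. P (winf_scale c winf_C)"
    and add: "\<And>x y. P x \<Longrightarrow> P y \<Longrightarrow> P (x + y)"
  shows "P x"
proof -
  have "P (\<Sum>b\<in>B. Poly_Mapping.single b (Poly_Mapping.lookup x b))" if "finite B" for B
    using that
  proof induction
    case empty
    show ?case using monom[of 0 0] by simp
  next
    case (insert b B)
    have "P (Poly_Mapping.single b c)" for c
      by (cases b) (simp_all add: single_Ww single_Cw monom C)
    with insert show ?case by (simp add: add)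
  qed
  then show ?thesis by (metis poly_mapping_eq_sum_single finite_keys)
qed

text \<open>Indices outside the supports carry a zero coefficient. A common index set is what allows
  brackets of \<open>x\<close>, \<open>x'\<close> and \<open>x + x'\<close> to be compared
  termwise.\<close>

lemma winf_bracket_superset:
  assumes "finite A" "Poly_Mapping.keys x \<subseteq> A" "finite B" "Poly_Mapping.keys y \<subseteq> B"
  shows "winf_bracket x y = (\<Sum>b\<in>A. \<Sum>c\<in>B.
    winf_scale (Poly_Mapping.lookup x b * Poly_Mapping.lookup y c) (winf_basis_bracket b c))"
proof -
  have "winf_bracket x y = (\<Sum>b\<in>Poly_Mapping.keys x. \<Sum>c\<in>B.
      winf_scale (Poly_Mapping.lookup x b * Poly_Mapping.lookup y c) (winf_basis_bracket b c))"
    unfolding winf_bracket_def using assms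
    by (intro sum.cong refl sum.mono_neutral_left) (auto simp: in_keys_iff)
  also have "\<dots> = (\<Sum>b\<in>A. \<Sum>c\<in>B.
      winf_scale (Poly_Mapping.lookup x b * Poly_Mapping.lookup y c) (winf_basis_bracket b c))"
    using assms by (intro sum.mono_neutral_left) (auto simp: in_keys_iff)
  finally show ?thesis .
qed

lemma winf_bracket_add_left: "winf_bracket (x + x') y = winf_bracket x y + winf_bracket x' y"
proof -
  let ?A = "Poly_Mapping.keys x \<union> Poly_Mapping.keys x' \<union> Poly_Mapping.keys (x + x')"
  show ?thesis
    by (subst (1 2 3) winf_bracket_superset[of ?A _ "Poly_Mapping.keys y"])
       (auto simp: lookup_add distrib_right winf.scale_left_distrib sum.distrib)
qed

lemma winf_bracket_add_right: "winf_bracket x (y + y') = winf_bracket x y + winf_bracket x y'"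
proof -
  let ?A = "Poly_Mapping.keys y \<union> Poly_Mapping.keys y' \<union> Poly_Mapping.keys (y + y')"
  show ?thesis
    by (subst (1 2 3) winf_bracket_superset[of "Poly_Mapping.keys x" _ ?A])
       (auto simp: lookup_add distrib_left winf.scale_left_distrib sum.distrib)
qed

lemma winf_bracket_scale_left: "winf_bracket (winf_scale c x) y = winf_scale c (winf_bracket x y)"
  by (subst winf_bracket_superset[of "Poly_Mapping.keys x" _ "Poly_Mapping.keys y"])
     (auto simp: winf_bracket_def winf.scale_sum_right in_keys_iff mult.assoc)

lemma winf_bracket_scale_right: "winf_bracket x (winf_scale c y) = winf_scale c (winf_bracket x y)"
  by (subst winf_bracket_superset[of "Poly_Mapping.keys x" _ "Poly_Mapping.keys y"])
     (auto simp: winf_bracket_def winf.scale_sum_right in_keys_iff mult_ac)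

lemma winf_bracket_sum_left: "winf_bracket (sum f A) y = (\<Sum>i\<in>A. winf_bracket (f i) y)"
  by (rule additive.sum) (standard, rule winf_bracket_add_left)

lemma winf_bracket_sum_right: "winf_bracket x (sum f A) = (\<Sum>i\<in>A. winf_bracket x (f i))"
  by (rule additive.sum) (standard, rule winf_bracket_add_right)

lemma winf_linear_left: "Vector_Spaces.linear winf_scale winf_scale (\<lambda>x. winf_bracket x y)"
  unfolding Vector_Spaces.linear_iff
  by (simp add: winf.vector_space_axioms winf_bracket_add_left winf_bracket_scale_left)

lemma winf_linear_right: "Vector_Spaces.linear winf_scale winf_scale (\<lambda>y. winf_bracket x y)"
  unfolding Vector_Spaces.linear_iff
  by (simp add: winf.vector_space_axioms winf_bracket_add_right winf_bracket_scale_right)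

lemma winf_bracket_single:
  "winf_bracket (Poly_Mapping.single b 1) (Poly_Mapping.single c 1) = winf_basis_bracket b c"
  by (subst winf_bracket_superset[of "{b}" _ "{c}"]) auto

lemma winf_basis_bracket_Cw [simp]: "winf_basis_bracket b Cw = 0" "winf_basis_bracket Cw b = 0"
  by (cases b; simp)+

lemma winf_bracket_C [simp]: "winf_bracket x winf_C = 0" "winf_bracket winf_C x = 0"
  by (simp_all add: winf_bracket_def winf_C_def)

text \<open>The factor r! s! in the basis bracket cancels the denominators of both series
  coefficients.\<close>

lemma winf_bracket_monom_1:
  "winf_bracket (winf_monom (monom 1 r) m) (winf_monom (monom 1 s) n) =
    winf_monom (comm_part (monom 1 r) m (monom 1 s) n) (m + n)
    + winf_scale (cocycle (monom 1 r) m (monom 1 s) n) winf_C"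
proof -
  have main: "[:of_int n, 1:] ^ r * [:0, 1:] ^ s - [:0, 1:] ^ r * [:of_int m, 1:] ^ s
      = comm_part (monom 1 r) m (monom 1 s) n"
    by (simp add: comm_part_def shift_def monom_altdef pcompose_power pcompose_pCons)
  show ?thesis
    unfolding single_Ww[symmetric] winf_bracket_single
    by (simp add: winf_main_series_nth winf_central_series_nth winf_monom_smult main
        winf.scale_right_distrib cocycle_def poly_monom)
qed

text \<open>Both sides are bilinear in \<open>F\<close> and \<open>G\<close>, so the formula spreads
  from pure powers of D to all polynomials.\<close>

lemma winf_bracket_monom:
  "winf_bracket (winf_monom F m) (winf_monom G n) =
    winf_monom (comm_part F m G n) (m + n) + winf_scale (cocycle F m G n) winf_C"
proof (induction F rule: poly_induct_monom_add)
  case (add F F')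
  then show ?case
    by (simp add: winf_monom_add winf_bracket_add_left comm_part_add_left cocycle_add_left
        winf.scale_left_distrib)
next
  case (monom a r)
  show ?case
  proof (induction G rule: poly_induct_monom_add)
    case (add G G')
    then show ?case
      by (simp add: winf_monom_add winf_bracket_add_right comm_part_add_right cocycle_add_right
          winf.scale_left_distrib)
  next
    case (monom b s)
    have monom: "monom c i = smult c (monom 1 i)" for c :: 'a and i
      by (simp add: smult_monom)
    have comm_part: "comm_part (smult a F) m (smult b G) n = smult (a * b) (comm_part F m G n)"
      for F G :: "'a poly"
      by (simp add: comm_part_def shift_def pcompose_smult smult_diff_right mult.commute)
    have "cocycle (smult a F) m (smult b G) n = (a * b) * cocycle F m G n" for F G :: "'a poly"
      by (simp add: cocycle_def isum_def sum_distrib_left right_diff_distrib mult_ac)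
    then show ?case
      by (simp only: monom[of a] monom[of b] winf_monom_smult winf_bracket_scale_left
          winf_bracket_scale_right winf_bracket_monom_1 comm_part)
         (simp add: winf.scale_right_distrib mult_ac)
  qed
qed

section \<open>Antisymmetry and the Jacobi identity of
  \<open>W\<^sub>1\<^sub>+\<^sub>\<infinity>\<close>\<close>

lemma winf_bracket_antisym: "winf_bracket x y = - winf_bracket y x"
proof (induction x rule: winf_induct)
  case (monom F m)
  show ?case
  proof (induction y rule: winf_induct)
    case (monom G n)
    show ?case
      by (subst (1 2) winf_bracket_monom, subst comm_part_antisym, subst cocycle_antisym)
         (simp add: winf_monom_uminus add.commute)
  qed (simp_all add: winf_bracket_scale_left winf_bracket_scale_right
      winf_bracket_add_left winf_bracket_add_right)
qed (simp_all add: winf_bracket_scale_left winf_bracket_scale_right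
    winf_bracket_add_left winf_bracket_add_right)

definition jacobiator :: "'a::field_char_0 winf \<Rightarrow> 'a winf \<Rightarrow> 'a winf \<Rightarrow> 'a winf" where
  "jacobiator x y z = winf_bracket x (winf_bracket y z) + winf_bracket y (winf_bracket z x)
     + winf_bracket z (winf_bracket x y)"

lemma jacobiator_rotate: "jacobiator x y z = jacobiator y z x"
  by (simp add: jacobiator_def add_ac)

text \<open>The jacobiator is additive in its first argument, and each of its terms vanishes there
  on the central C.\<close>

lemma jacobiator_eq_0_if_monom:
  assumes "\<And>F n. jacobiator (winf_monom F n) y z = 0"
  shows "jacobiator x y z = 0"
proof (induction x rule: winf_induct)
  case (C c)
  have "winf_bracket (winf_scale c winf_C) u = 0" "winf_bracket u (winf_scale c winf_C) = 0" for u :: "'a winf"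
    by (simp_all add: winf_bracket_scale_left winf_bracket_scale_right)
  moreover have "winf_bracket u 0 = 0" for u :: "'a winf"
    by (simp add: winf_bracket_def)
  ultimately show ?case by (simp add: jacobiator_def)
next
  case (add x x')
  have "jacobiator (x + x') y z = jacobiator x y z + jacobiator x' y z"
    by (simp add: jacobiator_def winf_bracket_add_left winf_bracket_add_right add_ac)
  then show ?case by (simp add: add)
qed (rule assms)

lemma jacobiator_monom: "jacobiator (winf_monom F m) (winf_monom G n) (winf_monom H p) = 0"
proof -
  \<comment> \<open>The inner central term is annihilated. Antisymmetry of the cocycle, whence the
    minus sign, brings the outer one to the shape of \<open>cocycle_jacobi\<close>.\<close>
  have br: "winf_bracket (winf_monom F m) (winf_bracket (winf_monom G n) (winf_monom H p))
      = winf_monom (comm_part F m (comm_part G n H p) (n + p)) (m + n + p)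
        - winf_scale (cocycle (comm_part G n H p) (n + p) F m) winf_C" for F G H :: "'a poly" and m n p
    by (simp add: winf_bracket_monom winf_bracket_add_right winf_bracket_scale_right add.assoc
        cocycle_antisym[of F m])
  have "jacobiator (winf_monom F m) (winf_monom G n) (winf_monom H p)
      = winf_monom (comm_part F m (comm_part G n H p) (n + p)
          + comm_part G n (comm_part H p F m) (p + m)
          + comm_part H p (comm_part F m G n) (m + n)) (m + n + p)
        - winf_scale (cocycle (comm_part F m G n) (m + n) H p
          + cocycle (comm_part G n H p) (n + p) F m
          + cocycle (comm_part H p F m) (p + m) G n) winf_C"
    by (simp add: jacobiator_def br winf_monom_add winf.scale_left_distrib add_ac)
  then show ?thesis by (simp only: comm_part_jacobi cocycle_jacobi) simp
qed

lemma jacobiator_eq_0: "jacobiator x y z = 0"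
proof (rule jacobiator_eq_0_if_monom)
  fix F m
  \<comment> \<open>Only the first slot can be reduced to generators, so cyclic rotation brings each
    remaining argument there in turn.\<close>
  have "jacobiator y z (winf_monom F m) = 0"
  proof (rule jacobiator_eq_0_if_monom)
    fix G n
    have "jacobiator z (winf_monom F m) (winf_monom G n) = 0"
      by (rule jacobiator_eq_0_if_monom) (rule jacobiator_monom)
    then show "jacobiator (winf_monom G n) z (winf_monom F m) = 0"
      by (simp add: jacobiator_rotate[of "winf_monom G n"])
  qed
  then show "jacobiator (winf_monom F m) y z = 0"
    by (simp add: jacobiator_rotate[of "winf_monom F m"])
qed

lemma lie_algebra_winf: "lie_algebra winf_scale winf_bracket"
proof (intro lie_algebra.intro lie_algebra_axioms.intro)
  fix x y z :: "'a winf"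
  \<comment> \<open>Antisymmetry only says that twice the bracket vanishes; characteristic zero
    removes the 2.\<close>
  have "winf_scale 2 (winf_bracket x x) = winf_bracket x x + winf_bracket x x"
    using winf.scale_left_distrib[of 1 1] by simp
  also have "\<dots> = 0" using winf_bracket_antisym[of x x] by (simp add: eq_neg_iff_add_eq_0)
  finally show "winf_bracket x x = 0" by simp
  show "winf_bracket x (winf_bracket y z) + winf_bracket y (winf_bracket z x)
      + winf_bracket z (winf_bracket x y) = 0"
    using jacobiator_eq_0[of x y z] by (simp add: jacobiator_def)
qed (fact winf.vector_space_axioms winf_linear_left winf_linear_right)+


section \<open>The comparison map\<close>

lemma lookup_fst_frobW_scale [simp]:
  "Poly_Mapping.lookup (fst (frobW_scale c x)) n = smult c (Poly_Mapping.lookup (fst x) n)"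
  by (simp add: frobW_scale_def Poly_Mapping.map.rep_eq when_def)

lemma snd_frobW_scale [simp]: "snd (frobW_scale c x) = c * snd x"
  by (simp add: frobW_scale_def)

lemma frobW_eqI:
  assumes "\<And>n. Poly_Mapping.lookup (fst x) n = Poly_Mapping.lookup (fst y) n" "snd x = snd y"
  shows "x = y"
  using assms by (auto intro!: prod_eqI poly_mapping_eqI)

interpretation frobW: vector_space frobW_scale
  by standard (auto intro!: frobW_eqI simp: lookup_add algebra_simps smult_add_left smult_add_right)

lemma frobW_monom_add: "frobW_monom (f + g) n = frobW_monom f n + frobW_monom g n"
  by (simp add: frobW_monom_def single_add)

lemma frobW_monom_smult: "frobW_monom (smult c f) n = frobW_scale c (frobW_monom f n)"
  by (rule frobW_eqI) (auto simp: frobW_monom_def lookup_single when_def)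

lemma frobW_eq_sum:
  "x = (\<Sum>n\<in>Poly_Mapping.keys (fst x). frobW_monom (Poly_Mapping.lookup (fst x) n) n)
     + frobW_scale (snd x) frobW_C"
  by (rule frobW_eqI)
     (auto simp: frobW_monom_def frobW_C_def fst_sum snd_sum lookup_add lookup_sum lookup_single
        when_def in_keys_iff)

definition recenter :: "int \<Rightarrow> 'a::field_char_0 poly \<Rightarrow> 'a poly" where
  "recenter n f = pcompose f [:of_int (n + 1) / 2, 1:]"

text \<open>On k[X]z^n the linear extension of the prescribed values is a substitution for X, so no
  expansion into powers of X is required.\<close>

definition comparison :: "'a::field_char_0 frobW \<Rightarrow> 'a winf" where
  "comparison x =
     (\<Sum>n\<in>Poly_Mapping.keys (fst x). winf_monom (recenter n (Poly_Mapping.lookup (fst x) n)) n)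
     + winf_scale (snd x) winf_C"

lemma lookup_comparison:
  "Poly_Mapping.lookup (comparison x) b = (case b of Cw \<Rightarrow> snd x
     | Ww n r \<Rightarrow> coeff (recenter n (Poly_Mapping.lookup (fst x) n)) r)"
  by (auto simp: comparison_def lookup_add lookup_sum lookup_winf_monom lookup_winf_C
      in_keys_iff recenter_def split: winf_basis.split)

lemma linear_comparison: "Vector_Spaces.linear frobW_scale winf_scale comparison"
  unfolding Vector_Spaces.linear_iff
  by (auto intro!: frobW.vector_space_axioms winf.vector_space_axioms poly_mapping_eqI
      simp: lookup_comparison lookup_add recenter_def pcompose_add pcompose_smult
      split: winf_basis.split)

lemma comparison_monom: "comparison (frobW_monom f n) = winf_monom (recenter n f) n"
  by (auto intro!: poly_mapping_eqI simp: lookup_comparison frobW_monom_def lookup_winf_monom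
      lookup_single when_def recenter_def split: winf_basis.split)

lemma comparison_C: "comparison frobW_C = winf_C"
  by (auto intro!: poly_mapping_eqI simp: lookup_comparison frobW_C_def lookup_winf_C recenter_def
      split: winf_basis.split)

lemma recenter_monom: "recenter n (monom 1 r) = [:of_int (n + 1) / 2, 1:] ^ r"
  by (simp add: recenter_def monom_altdef pcompose_power pcompose_pCons)

lemma is_comparison_map_comparison: "is_comparison_map comparison"
  by (simp add: is_comparison_map_def linear_comparison comparison_monom comparison_C recenter_monom)

text \<open>The elements X^r z^n together with C span the domain, so linearity leaves no
  freedom.\<close>

lemma is_comparison_map_unique:
  assumes "is_comparison_map \<phi>"
  shows "\<phi> = comparison"
proof
  interpret phi: Vector_Spaces.linear frobW_scale winf_scale \<phi>
    using assms by (simp add: is_comparison_map_def)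
  have C: "\<phi> frobW_C = winf_C"
    and r: "\<phi> (frobW_monom (monom 1 r) n) = winf_monom (recenter n (monom 1 r)) n" for r n
    using assms by (simp_all add: is_comparison_map_def recenter_monom)
  have monom: "\<phi> (frobW_monom f n) = winf_monom (recenter n f) n" for f n
  proof (induction f rule: poly_induct_monom_add)
    case (monom a r)
    have "\<phi> (frobW_monom (smult a (monom 1 r)) n) = winf_monom (recenter n (smult a (monom 1 r))) n"
      by (simp only: frobW_monom_smult phi.scale r recenter_def pcompose_smult winf_monom_smult)
    then show ?case by (simp add: smult_monom)
  next
    case (add f g)
    then show ?case
      by (simp add: frobW_monom_add phi.add recenter_def pcompose_add winf_monom_add)
  qed
  fix x
  show "\<phi> x = comparison x"
    by (subst frobW_eq_sum) (simp add: phi.add phi.sum phi.scale monom C comparison_def)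
qed

lemma comparison_bracket:
  "comparison (frobW_bracket x y) = winf_bracket (comparison x) (comparison y)"
proof -
  interpret C: Vector_Spaces.linear frobW_scale winf_scale comparison
    by (rule linear_comparison)
  have monom: "comparison (frobW_monom (star m n f g) (m + n) + frobW_scale (Psi f m g n) frobW_C)
      = winf_bracket (winf_monom (recenter m f) m) (winf_monom (recenter n g) n)"
    for f g :: "'a poly" and m n
  proof -
    have "recenter (m + n) (star m n f g) = comm_part (recenter m f) m (recenter n g) n"
    proof -
      \<comment> \<open>After recentring at m + n, the half-integer shifts of \<open>star\<close>
        become the recentrings of the two factors, followed by an integer shift by n, 0, 0 and m
        respectively.\<close>
      have "of_int n / 2 + of_int (m + n + 1) / 2 = of_int (m + 1) / 2 + (of_int n :: 'a)"
        "- (of_int m / 2) + of_int (m + n + 1) / 2 = (of_int (n + 1) / 2 :: 'a)"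
        "- (of_int n / 2) + of_int (m + n + 1) / 2 = (of_int (m + 1) / 2 :: 'a)"
        "of_int m / 2 + of_int (m + n + 1) / 2 = of_int (n + 1) / 2 + (of_int m :: 'a)"
        by (simp_all add: field_simps)
      then show ?thesis
        by (simp only: recenter_def star_eq comm_part_def shift_def pcompose_diff pcompose_mult
            pcompose_translate)
    qed
    moreover have "Psi f m g n = cocycle (recenter m f) m (recenter n g) n"
    proof (cases "m = - n")
      case True
      \<comment> \<open>The summand 1/2 of the recentring is decisive here: it makes k - m and k,
        the arguments of the two factors in \<open>cocycle\<close>, both land on the node k + (1 -
        m)/2 of \<open>Psi_eq\<close>.\<close>
      have "of_int (1 - m) / 2 + of_int k = of_int (m + 1) / 2 + (of_int (k - m) :: 'a)" for k
        by (simp add: field_simps)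
      then show ?thesis
        using True by (simp add: Psi_eq cocycle_def recenter_def poly_pcompose) (simp add: field_simps)
    qed (simp add: Psi_eq cocycle_def)
    ultimately show ?thesis
      by (simp add: C.add C.scale comparison_monom comparison_C winf_bracket_monom)
  qed
  have "comparison (frobW_bracket x y) =
      (\<Sum>m\<in>Poly_Mapping.keys (fst x). \<Sum>n\<in>Poly_Mapping.keys (fst y).
        winf_bracket (winf_monom (recenter m (Poly_Mapping.lookup (fst x) m)) m)
          (winf_monom (recenter n (Poly_Mapping.lookup (fst y) n)) n))"
    by (simp only: frobW_bracket_def Let_def C.sum monom)
  \<comment> \<open>The central summands drop out of the bracket, and the two expansions then differ
    only in the order of the double sum.\<close>
  also have "\<dots> = winf_bracket (comparison x) (comparison y)"
    unfolding comparison_def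
    by (simp add: winf_bracket_add_left winf_bracket_add_right winf_bracket_scale_left
        winf_bracket_scale_right winf_bracket_sum_left winf_bracket_sum_right)
       (rule sum.swap)
  finally show ?thesis .
qed

section \<open>Bijectivity and transport of the Lie algebra structure\<close>

lemma recenter_inverse: "recenter n (pcompose f [:- (of_int (n + 1) / 2), 1:]) = f"
  by (simp add: recenter_def pcompose_translate)

lemma recenter_inject: "recenter n f = recenter n g \<longleftrightarrow> f = g"
proof -
  have "pcompose (recenter n h) [:- (of_int (n + 1) / 2), 1:] = h" for h :: "'a poly"
    by (simp add: recenter_def pcompose_translate)
  then show ?thesis by metis
qed

text \<open>For each exponent of z the map is an invertible translation of the variable, and it
  matches the coefficients of C.\<close>

lemma bij_comparison: "bij (comparison :: 'a::field_char_0 frobW \<Rightarrow> 'a winf)"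
proof (rule bijI)
  show "inj (comparison :: 'a frobW \<Rightarrow> _)"
  proof (rule injI)
    fix x y :: "'a frobW"
    assume eq: "comparison x = comparison y"
    have "recenter n (Poly_Mapping.lookup (fst x) n) = recenter n (Poly_Mapping.lookup (fst y) n)" for n
      using arg_cong[OF eq, of "\<lambda>z. Poly_Mapping.lookup z (Ww n r)" for r]
      by (auto intro!: poly_eqI simp: lookup_comparison)
    moreover have "snd x = snd y"
      using arg_cong[OF eq, of "\<lambda>z. Poly_Mapping.lookup z Cw"] by (simp add: lookup_comparison)
    ultimately show "x = y" by (auto intro: frobW_eqI simp: recenter_inject)
  qed
  interpret C: Vector_Spaces.linear frobW_scale winf_scale "comparison :: 'a frobW \<Rightarrow> _"
    by (rule linear_comparison)
  have "y \<in> range comparison" for y :: "'a winf"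
  proof (induction y rule: winf_induct)
    case (monom F n)
    show ?case by (metis comparison_monom recenter_inverse rangeI)
  next
    case (C c)
    show ?case by (metis C.scale comparison_C rangeI)
  next
    case (add x y)
    then show ?case by (auto simp flip: C.add)
  qed
  then show "surj (comparison :: 'a frobW \<Rightarrow> _)" by auto
qed

text \<open>Every bracket axiom is an equation, hence can be checked after applying the injective,
  linear, bracket-preserving \<open>comparison\<close>.\<close>

lemma lie_algebra_frobW: "lie_algebra frobW_scale (frobW_bracket :: 'a::field_char_0 frobW \<Rightarrow> _)"
proof -
  interpret C: Vector_Spaces.linear frobW_scale winf_scale comparison
    by (rule linear_comparison)
  interpret W: lie_algebra winf_scale winf_bracket
    by (rule lie_algebra_winf)
  have eqI: "x = y" if "comparison x = comparison y" for x y :: "'a frobW"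
    using that bij_comparison by (metis bij_is_inj injD)
  note simps = comparison_bracket C.add C.scale winf_bracket_add_left winf_bracket_add_right
    winf_bracket_scale_left winf_bracket_scale_right
  show ?thesis
  proof (intro lie_algebra.intro lie_algebra_axioms.intro)
    show "vector_space (frobW_scale :: 'a \<Rightarrow> _)"
      by (rule frobW.vector_space_axioms)
    fix x y z :: "'a frobW"
    show "Vector_Spaces.linear frobW_scale frobW_scale (\<lambda>x. frobW_bracket x y)"
      "Vector_Spaces.linear frobW_scale frobW_scale (\<lambda>y. frobW_bracket x y)"
      unfolding Vector_Spaces.linear_iff
      by (intro conjI allI frobW.vector_space_axioms eqI; simp add: simps)+
    show "frobW_bracket x x = 0"
      by (rule eqI) (simp add: simps W.alternating)
    show "frobW_bracket x (frobW_bracket y z) + frobW_bracket y (frobW_bracket z x)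
        + frobW_bracket z (frobW_bracket x y) = 0"
      by (rule eqI) (simp add: simps W.jacobi)
  qed
qed

theorem proposition3p3:
  shows "(\<exists>!\<phi> :: 'a::field_char_0 frobW \<Rightarrow> 'a winf. is_comparison_map \<phi>) \<and>
    (\<forall>\<phi> :: 'a frobW \<Rightarrow> 'a winf. is_comparison_map \<phi> \<longrightarrow>
       lie_algebra_iso frobW_scale frobW_bracket winf_scale winf_bracket \<phi>)"
proof (intro conjI allI impI)
  show "\<exists>!\<phi> :: 'a frobW \<Rightarrow> 'a winf. is_comparison_map \<phi>"
    using is_comparison_map_comparison is_comparison_map_unique by blast
next
  fix \<phi> :: "'a frobW \<Rightarrow> 'a winf"
  assume "is_comparison_map \<phi>"
  then have "\<phi> = comparison" by (rule is_comparison_map_unique)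
  then show "lie_algebra_iso frobW_scale frobW_bracket winf_scale winf_bracket \<phi>"
    by (simp add: lie_algebra_iso_def lie_algebra_iso_axioms_def lie_algebra_frobW lie_algebra_winf
        linear_comparison comparison_bracket bij_comparison)
qed

end
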